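(* Let $2\le n<d$ be integers. For any cyclic group $\Gamma=\langle M_{d;\alpha_0,\dots,\alpha_n}\rangle\subset\mathrm{GL}(n+1,\mathbb{K})$ of order $d$ as in the context, the ideal $\mathrm{relint}(I_d)$ of $R^{\overline{\Gamma}}$ satisfies $\mathrm{relint}(I_d)=\langle\mathcal{C}_{d,1},\mathcal{C}_{d,2}\rangle$, i.e. it is generated, as an ideal of $R^{\overline{\Gamma}}$, by its monomials of degree $d$ and $2d$.
   Context: $\mathbb{K}$ is an algebraically closed field of characteristic zero and $R=\mathbb{K}[x_0,\dots,x_n]$. Fix $e\in\mathbb{K}$ a primitive $d$-th root of $1$, and integers $0\le\alpha_0\le\cdots\le\alpha_n<d$ with $\mathrm{GCD}(d,\alpha_0,\dots,\alpha_n)=1$ and $\alpha_i<\alpha_j$ for some $i\ne j$. $M_{d;\alpha_0,\dots,\alpha_n}=\mathrm{diag}(e^{\alpha_0},\dots,e^{\alpha_n})$ acts on $R$ by $x_i\mapsto e^{\alpha_i}x_i$. $\overline{\Gamma}\subset\mathrm{GL}(n+1,\mathbb{K})$ is the finite abelian group generated by $M_{d;\alpha_0,\dots,\alpha_n}$ and $\mathrm{diag}(e,\dots,e)$; its ring of invariants $R^{\overline{\Gamma}}$ is spanned over $\mathbb{K}$ by the monomials $x_0^{a_0}\cdots x_n^{a_n}$ with $a_0+\cdots+a_n\equiv 0\pmod d$ and $\alpha_0a_0+\cdots+\alpha_na_n\equiv 0\pmod d$. $I_d$ denotes the ideal of $R$ generated by all monomial invariants of $\Gamma$ of degree $d$.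 $\mathrm{relint}(I_d)$ is the ideal of $R^{\overline{\Gamma}}$ generated by all monomials $x_0^{a_0}\cdots x_n^{a_n}\in R^{\overline{\Gamma}}$ with $a_0\cdots a_n\neq 0$. For $k\ge1$, $\mathcal{C}_{d,k}\subset\mathrm{relint}(I_d)$ is the set of all monomials of $\mathrm{relint}(I_d)$ of degree $kd$ (degree taken in $R$). *)

theory Defs
  imports
    "HOL-Computational_Algebra.Polynomial"
    "Jordan_Normal_Form.Matrix"
    "HOL-Algebra.Generated_Groups"
    "HOL-Algebra.Ideal"
    "HOL-Library.Poly_Mapping"
begin

text \<open>
  Monomials are exponent vectors \<open>nat \<Rightarrow>\<^sub>0 nat\<close>, and polynomials are finitely supported
  functions from exponent vectors to coefficients, multiplied by convolution.
  \<open>poly_ring n\<close> is \<open>K[x_0,\<dots>,x_n]\<close>: the polynomials in which only variables of index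
  at most \<open>n\<close> occur.
\<close>

type_synonym 'a mpoly = "(nat \<Rightarrow>\<^sub>0 nat) \<Rightarrow>\<^sub>0 'a"

definition poly_ring :: "nat \<Rightarrow> 'a::comm_ring_1 mpoly ring" where
  "poly_ring n =
    \<lparr>carrier = {p. \<forall>m \<in> Poly_Mapping.keys p. Poly_Mapping.keys m \<subseteq> {..n}},
     monoid.mult = (*), one = 1, zero = 0, add = (+)\<rparr>"

definition const :: "'a::comm_ring_1 \<Rightarrow> 'a mpoly" where
  "const c = Poly_Mapping.single 0 c"

definition var :: "nat \<Rightarrow> 'a::comm_ring_1 mpoly" where
  "var i = Poly_Mapping.single (Poly_Mapping.single i 1) 1"

definition mon :: "(nat \<Rightarrow>\<^sub>0 nat) \<Rightarrow> 'a::comm_ring_1 mpoly" where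
  "mon a = Poly_Mapping.single a 1"

definition mon_degree :: "(nat \<Rightarrow>\<^sub>0 nat) \<Rightarrow> nat" where
  "mon_degree a = (\<Sum>i \<in> Poly_Mapping.keys a. Poly_Mapping.lookup a i)"

definition GL :: "nat \<Rightarrow> 'a::field mat monoid" where
  "GL N = units_of (ring_mat TYPE('a) N ())"

text \<open>
  The linear substitution \<open>x_i \<mapsto> \<Sum>\<^sub>j A\<^sub>i\<^sub>j x_j\<close>. For a diagonal matrix it is
  \<open>x_i \<mapsto> A\<^sub>i\<^sub>i x_i\<close>, so the choice between rows and columns is immaterial here.
\<close>

definition act :: "'a::comm_ring_1 mat \<Rightarrow> 'a mpoly \<Rightarrow> 'a mpoly" where
  "act A p = (\<Sum>m \<in> Poly_Mapping.keys p. const (Poly_Mapping.lookup p m) *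
      (\<Prod>i < dim_row A. (\<Sum>j < dim_col A. const (A $$ (i, j)) * var j) ^ Poly_Mapping.lookup m i))"

definition invariant_ring :: "nat \<Rightarrow> 'a::comm_ring_1 mat set \<Rightarrow> 'a mpoly ring" where
  "invariant_ring n G =
    (poly_ring n) \<lparr>carrier := {p \<in> carrier (poly_ring n). \<forall>A \<in> G. act A p = p}\<rparr>"

definition primitive_root_of_unity :: "nat \<Rightarrow> 'a::field \<Rightarrow> bool" where
  "primitive_root_of_unity d e \<longleftrightarrow> 0 < d \<and> e ^ d = 1 \<and> (\<forall>k. 0 < k \<and> k < d \<longrightarrow> e ^ k \<noteq> 1)"

text \<open>The matrix \<open>diag(e^\<alpha>_0, \<dots>, e^\<alpha>_n)\<close>.\<close>

definition diag_M :: "nat \<Rightarrow> 'a::field \<Rightarrow> (nat \<Rightarrow> nat) \<Rightarrow> 'a mat" where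
  "diag_M n e \<alpha> = mat_diag (n + 1) (\<lambda>i. e ^ \<alpha> i)"

definition Gam :: "nat \<Rightarrow> 'a::field \<Rightarrow> (nat \<Rightarrow> nat) \<Rightarrow> 'a mat set" where
  "Gam n e \<alpha> = generate (GL (n + 1)) {diag_M n e \<alpha>}"

definition Gam_bar :: "nat \<Rightarrow> 'a::field \<Rightarrow> (nat \<Rightarrow> nat) \<Rightarrow> 'a mat set" where
  "Gam_bar n e \<alpha> = generate (GL (n + 1)) {diag_M n e \<alpha>, mat_diag (n + 1) (\<lambda>_. e)}"

definition R_Gam_bar :: "nat \<Rightarrow> 'a::field \<Rightarrow> (nat \<Rightarrow> nat) \<Rightarrow> 'a mpoly ring" where
  "R_Gam_bar n e \<alpha> = invariant_ring n (Gam_bar n e \<alpha>)"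

definition relint_I :: "nat \<Rightarrow> 'a::field \<Rightarrow> (nat \<Rightarrow> nat) \<Rightarrow> 'a mpoly set" where
  "relint_I n e \<alpha> =
    Idl\<^bsub>R_Gam_bar n e \<alpha>\<^esub>
      {mon a | a. mon a \<in> carrier (R_Gam_bar n e \<alpha>) \<and> (\<Prod>i\<le>n. Poly_Mapping.lookup a i) \<noteq> 0}"

definition C_set :: "nat \<Rightarrow> 'a::field \<Rightarrow> (nat \<Rightarrow> nat) \<Rightarrow> nat \<Rightarrow> nat \<Rightarrow> 'a mpoly set" where
  "C_set n e \<alpha> d k = {mon a | a. mon a \<in> relint_I n e \<alpha> \<and> mon_degree a = k * d}"

end

theory Submission
  imports Defs "HOL-Number_Theory.Residues"
begin

text \<open>
  A monomial lies in the invariant ring iff $d$ divides both its degree and its weighted degree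
  $\sum_i \alpha_i a_i$. Let all $a_i$ be positive and the degree be at least $3d$. Removing one copy
  of each variable leaves degree at least $3d - (n+1) \ge 2d$, so by the
  Erdos-Ginzburg-Ziv theorem some $d$ of the remaining variables have weights summing to $0$ modulo
  $d$. Their product is an invariant of degree $d$, and dividing by it keeps all exponents positive.
  Iterating brings the degree down to $d$ or $2d$.
\<close>

section \<open>The theorem of Erdos, Ginzburg and Ziv\<close>

lemma prime_dvd_binomial:
  fixes p :: nat
  assumes "prime p" "p \<le> m" "r < p" "m - r < p"
  shows "p dvd m choose r"
proof -
  have "p dvd fact r * fact (m - r) * (m choose r)"
    using assms by (simp add: binomial_fact_lemma prime_dvd_fact_iff)
  \<comment> \<open>Both \<open>r\<close> and \<open>m - r\<close> are below \<open>p\<close>, so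
    neither factorial is divisible by \<open>p\<close>, and the prime must divide the remaining
    factor.\<close>
  then show ?thesis
    using assms by (auto simp: prime_dvd_mult_iff prime_dvd_fact_iff)
qed

text \<open>Cancelling \<open>fact p\<close> from \<open>fact (2 * p - 1)\<close> leaves the product
  of the numbers strictly between \<open>p\<close> and \<open>2 * p\<close>, none of which is a
  multiple of \<open>p\<close>.\<close>

lemma prime_not_dvd_central_binomial:
  fixes p :: nat
  assumes "prime p"
  shows "\<not> p dvd (2 * p - 1) choose p"
proof
  assume "p dvd (2 * p - 1) choose p"
  have p: "p \<ge> 2"
    using assms by (rule prime_ge_2_nat)
  have "fact p * (fact (p - 1) * ((2 * p - 1) choose p)) = fact (2 * p - 1)"
    using binomial_fact_lemma[of p "2 * p - 1"] p by (simp add: ac_simps mult_2)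
  also have "\<dots> = fact p * \<Prod>{Suc p..2 * p - 1}"
    using p by (intro fact_eq_fact_times) simp
  finally have "fact (p - 1) * ((2 * p - 1) choose p) = \<Prod>{Suc p..2 * p - 1}"
    by simp
  then have "p dvd \<Prod>{Suc p..2 * p - 1}"
    using \<open>p dvd _\<close> by (metis dvd_mult)
  then obtain i where "i \<in> {Suc p..2 * p - 1}" "p dvd i"
    using assms by (auto simp: prime_dvd_prod_iff)
  then obtain k where "p * k \<ge> Suc p" "p * k \<le> 2 * p - 1"
    by auto
  then have "p * 1 < p * k" "p * k < p * 2"
    using p by linarith+
  then show False
    by (simp only: mult_less_cancel1) auto
qed

text \<open>Removing \<open>J\<close> is a bijection onto the subsets of \<open>S - J\<close> of
  size \<open>k - card J\<close>, with union by \<open>J\<close> as inverse. This counts how often a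
  given product recurs in the expanded power sums below.\<close>

lemma card_supersets:
  assumes "finite S" "J \<subseteq> S" "card J \<le> k"
  shows "card {T. T \<subseteq> S \<and> card T = k \<and> J \<subseteq> T} = (card S - card J) choose (k - card J)"
proof -
  have finJ: "finite J"
    using assms finite_subset by blast
  have "bij_betw (\<lambda>T. T - J) {T. T \<subseteq> S \<and> card T = k \<and> J \<subseteq> T}
      {U. U \<subseteq> S - J \<and> card U = k - card J}"
  proof (rule bij_betw_byWitness[where f' = "\<lambda>U. U \<union> J"])
    show "(\<lambda>U. U \<union> J) ` {U. U \<subseteq> S - J \<and> card U = k - card J}
        \<subseteq> {T. T \<subseteq> S \<and> card T = k \<and> J \<subseteq> T}"
    proof clarify
      fix U assume U: "U \<subseteq> S - J" "card U = k - card J"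
      have "card (U \<union> J) = card U + card J"
        using U finJ assms by (intro card_Un_disjoint) (auto intro: finite_subset)
      then show "U \<union> J \<subseteq> S \<and> card (U \<union> J) = k \<and> J \<subseteq> U \<union> J"
        using U assms by auto
    qed
  qed (use finJ in \<open>auto simp: card_Diff_subset\<close>)
  then have "card {T. T \<subseteq> S \<and> card T = k \<and> J \<subseteq> T} = card {U. U \<subseteq> S - J \<and> card U = k - card J}"
    by (rule bij_betw_same_card)
  also have "\<dots> = (card S - card J) choose (k - card J)"
    using assms finJ by (simp add: n_subsets card_Diff_subset)
  finally show ?thesis .
qed

text \<open>
  Were no $p$-subset sum divisible by $p$, the sum of the $(p-1)$-st powers of these sums would be
  congruent to $\binom{2p-1}{p} \not\equiv 0$ by Fermat. Expanding the powers, each product of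
  $p-1$ factors, involving $j$ distinct indices, occurs $\binom{2p-1-j}{p-j} \equiv 0$ times.
\<close>

lemma Erdos_Ginzburg_Ziv_prime:
  fixes a :: "'i \<Rightarrow> nat" and p :: nat
  assumes p: "prime p" and S: "finite S" "card S = 2 * p - 1"
  shows "\<exists>T\<subseteq>S. card T = p \<and> p dvd sum a T"
proof (rule ccontr)
  assume contra: "\<not> ?thesis"
  define F where "F = {T. T \<subseteq> S \<and> card T = p}"
  define K where "K = {..<p - 1}"
  have p2: "p \<ge> 2"
    using p by (rule prime_ge_2_nat)
  have finF: "finite F"
    using S by (simp add: F_def)
  have finT: "finite T" if "T \<in> F" for T
    using that S finite_subset by (auto simp: F_def)
  have "[(\<Sum>T\<in>F. sum a T ^ (p - 1)) = (\<Sum>T\<in>F. 1)] (mod p)"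
    by (intro cong_sum fermat_theorem p) (use contra in \<open>auto simp: F_def\<close>)
  also have "(\<Sum>T\<in>F. 1) = (2 * p - 1) choose p"
    using S by (simp add: F_def n_subsets)
  finally have not_dvd: "\<not> p dvd (\<Sum>T\<in>F. sum a T ^ (p - 1))"
    using prime_not_dvd_central_binomial[OF p] by (simp add: cong_dvd_iff)
  \<comment> \<open>A function \<open>f\<close> on \<open>K\<close> records which summand is picked
    from each of the \<open>p - 1\<close> factors.\<close>
  have "(\<Sum>T\<in>F. sum a T ^ (p - 1)) = (\<Sum>T\<in>F. \<Sum>f\<in>K \<rightarrow>\<^sub>E T. \<Prod>k\<in>K. a (f k))"
  proof (rule sum.cong)
    fix T assume "T \<in> F"
    then show "sum a T ^ (p - 1) = (\<Sum>f\<in>K \<rightarrow>\<^sub>E T. \<Prod>k\<in>K. a (f k))"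
      using prod_sum_PiE[of K "\<lambda>_. T" "\<lambda>_. a"] by (simp add: K_def finT)
  qed simp
  \<comment> \<open>Letting \<open>f\<close> take values in \<open>S\<close>, with its image
    constrained to \<open>T\<close>, makes the two summations exchangeable.\<close>
  also have "\<dots> = (\<Sum>T\<in>F. \<Sum>f\<in>{f. f \<in> K \<rightarrow>\<^sub>E S \<and> f ` K \<subseteq> T}. \<Prod>k\<in>K. a (f k))"
    by (intro sum.cong) (auto simp: F_def PiE_def)
  also have "\<dots> = (\<Sum>f\<in>K \<rightarrow>\<^sub>E S. \<Sum>T\<in>{T. T \<in> F \<and> f ` K \<subseteq> T}. \<Prod>k\<in>K. a (f k))"
    by (rule sum.swap_restrict) (use finF S in \<open>auto simp: K_def intro: finite_PiE\<close>)
  also have "\<dots> = (\<Sum>f\<in>K \<rightarrow>\<^sub>E S. card {T. T \<in> F \<and> f ` K \<subseteq> T} * (\<Prod>k\<in>K. a (f k)))"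
    by simp
  also have "p dvd \<dots>"
  proof (intro dvd_sum dvd_mult2)
    fix f assume f: "f \<in> K \<rightarrow>\<^sub>E S"
    have "card (f ` K) \<le> p - 1"
      using card_image_le[of K f] by (simp add: K_def)
    \<comment> \<open>Here \<open>K\<close> is nonempty because p \<ge> 2. An empty image would give
      the binomial coefficient just shown not to be divisible by \<open>p\<close>.\<close>
    moreover have "card (f ` K) \<noteq> 0"
      using p2 by (auto simp: K_def lessThan_empty_iff)
    moreover have "card {T. T \<in> F \<and> f ` K \<subseteq> T} = (2 * p - 1 - card (f ` K)) choose (p - card (f ` K))"
    proof -
      have "f ` K \<subseteq> S"
        using f by auto
      moreover have "card (f ` K) \<le> p"
        using \<open>card (f ` K) \<le> p - 1\<close> by simp
      ultimately show ?thesis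
        using card_supersets[of S "f ` K" p] S by (simp add: F_def conj_assoc)
    qed
    ultimately show "p dvd card {T. T \<in> F \<and> f ` K \<subseteq> T}"
      using p2 by (auto intro!: prime_dvd_binomial p)
  qed
  finally show False
    using not_dvd by simp
qed

text \<open>Greedy extraction: each set uses up \<open>p\<close> elements, and before the last of
  \<open>k\<close> extractions at least \<open>(k + 1) * p - 1 - (k - 1) * p = 2 * p - 1\<close>
  elements remain, just enough for the prime case.\<close>

lemma disjoint_zero_sum_subsets:
  fixes a :: "'i \<Rightarrow> nat" and p :: nat
  assumes p: "prime p" and "finite S" "card S \<ge> (k + 1) * p - 1"
  shows "\<exists>T. (\<forall>i<k. T i \<subseteq> S \<and> card (T i) = p \<and> p dvd sum a (T i)) \<and> disjoint_family_on T {..<k}"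
  using assms(2,3)
proof (induction k arbitrary: S)
  case 0
  show ?case by (simp add: disjoint_family_on_def)
next
  case (Suc k)
  have "2 * p \<le> (Suc k + 1) * p"
    by (intro mult_right_mono) auto
  then have "2 * p - 1 \<le> card S"
    using Suc.prems by linarith
  then obtain S' where "S' \<subseteq> S" "card S' = 2 * p - 1" "finite S'"
    by (metis obtain_subset_with_card_n)
  then obtain U where U: "U \<subseteq> S" "card U = p" "p dvd sum a U"
    using Erdos_Ginzburg_Ziv_prime[OF p, of S' a] by blast
  have "card (S - U) \<ge> (k + 1) * p - 1"
    using U Suc.prems by (auto simp: card_Diff_subset finite_subset)
  then obtain T where
    T: "\<And>i. i < k \<Longrightarrow> T i \<subseteq> S - U \<and> card (T i) = p \<and> p dvd sum a (T i)"
      and disj: "disjoint_family_on T {..<k}"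
    using Suc.IH[of "S - U"] Suc.prems by auto
  have "disjoint_family_on (T(k := U)) {..<Suc k}"
    using disj T unfolding disjoint_family_on_def lessThan_Suc by fastforce
  moreover have "\<forall>i<Suc k. (T(k := U)) i \<subseteq> S \<and> card ((T(k := U)) i) = p \<and> p dvd sum a ((T(k := U)) i)"
    using T U by (auto simp: less_Suc_eq)
  ultimately show ?case by blast
qed

text \<open>Induction over the prime factorization of \<open>d\<close>: for \<open>p * m\<close>,
  extract disjoint blocks of size \<open>p\<close> with sums divisible by \<open>p\<close>, then
  apply the case \<open>m\<close> to these sums divided by \<open>p\<close>. The index type is fixed
  to \<open>nat\<close> because the induction hypothesis is applied to the numbers of the blocks
  rather than to elements of \<open>S\<close>.\<close>

lemma Erdos_Ginzburg_Ziv_nat: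
  fixes a :: "nat \<Rightarrow> nat"
  assumes "d > 0" "finite S" "card S \<ge> 2 * d - 1"
  shows "\<exists>T\<subseteq>S. card T = d \<and> d dvd sum a T"
  using assms
proof (induction d arbitrary: a S rule: prime_divisors_induct)
  case (unit d)
  then have "card S \<ge> 1" "d = 1" by auto
  then show ?case
    by (metis obtain_subset_with_card_n one_dvd)
next
  case (factor p m)
  have m: "m > 0" and p: "p > 0"
    using factor.prems by auto
  \<comment> \<open>The left side equals \<open>2 * (p * m) - 1\<close>, so the bound yields the
    \<open>2 * m - 1\<close> blocks that the case \<open>m\<close> requires.\<close>
  have "(2 * m - 1 + 1) * p - 1 \<le> card S"
    using factor.prems m by (simp add: ac_simps)
  then obtain T where
    T: "\<And>i. i < 2 * m - 1 \<Longrightarrow> T i \<subseteq> S \<and> card (T i) = p \<and> p dvd sum a (T i)"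
      and disj: "disjoint_family_on T {..<2 * m - 1}"
    using disjoint_zero_sum_subsets[OF factor.hyps(1) \<open>finite S\<close>, of "2 * m - 1" a] by blast
  obtain U where U: "U \<subseteq> {..<2 * m - 1}" "card U = m" "m dvd (\<Sum>i\<in>U. sum a (T i) div p)"
    using factor.IH[of "{..<2 * m - 1}" "\<lambda>i. sum a (T i) div p"] m by auto
  have finU: "finite U"
    using U by (auto intro: finite_subset)
  have finT: "finite (T i)" if "i \<in> U" for i
    using that U(1) T[of i] \<open>finite S\<close> by (meson finite_subset lessThan_iff subsetD)
  have disjU: "\<forall>i\<in>U. \<forall>j\<in>U. i \<noteq> j \<longrightarrow> T i \<inter> T j = {}"
    using disj U by (auto simp: disjoint_family_on_def)
  have "card (\<Union>i\<in>U. T i) = (\<Sum>i\<in>U. card (T i))"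
    using finU finT disjU by (intro card_UN_disjoint) auto
  also have "\<dots> = (\<Sum>i\<in>U. p)"
    using U T by (intro sum.cong) auto
  finally have card: "card (\<Union>i\<in>U. T i) = p * m"
    using U by simp
  have "sum a (\<Union>i\<in>U. T i) = (\<Sum>i\<in>U. sum a (T i))"
    using finU finT disjU by (intro sum.UNION_disjoint) auto
  also have "\<dots> = (\<Sum>i\<in>U. p * (sum a (T i) div p))"
    using U T by (intro sum.cong) auto
  also have "\<dots> = p * (\<Sum>i\<in>U. sum a (T i) div p)"
    by (simp add: sum_distrib_left)
  finally have "p * m dvd sum a (\<Union>i\<in>U. T i)"
    using U by simp
  moreover have "(\<Union>i\<in>U. T i) \<subseteq> S"
    using U T by blast
  ultimately show ?case
    using card by blast
qed auto

text \<open>Arbitrary index types are handled by numbering the elements of \<open>S\<close>.\<close>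

theorem Erdos_Ginzburg_Ziv:
  fixes a :: "'i \<Rightarrow> nat"
  assumes "d > 0" "finite S" "card S \<ge> 2 * d - 1"
  shows "\<exists>T\<subseteq>S. card T = d \<and> d dvd sum a T"
proof -
  obtain h where h: "bij_betw h {..<card S} S"
    using \<open>finite S\<close> by (metis atLeast0LessThan ex_bij_betw_nat_finite)
  obtain T where T: "T \<subseteq> {..<card S}" "card T = d" "d dvd sum (a \<circ> h) T"
    using Erdos_Ginzburg_Ziv_nat[of d "{..<card S}" "a \<circ> h"] assms by auto
  have inj: "inj_on h T"
    using h T by (meson bij_betw_imp_inj_on inj_on_subset)
  have "h ` T \<subseteq> S" "card (h ` T) = d" "d dvd sum a (h ` T)"
    using h T inj by (auto simp: bij_betw_def card_image sum.reindex)
  then show ?thesis by blast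
qed

section \<open>Positive exponent vectors\<close>

text \<open>An exponent vector is read as a multiset: \<open>S\<close> holds \<open>u i\<close>
  labelled copies of each \<open>i\<close>, and \<open>c i\<close> counts the copies of
  \<open>i\<close> selected by the Erdos-Ginzburg-Ziv theorem.\<close>

lemma zero_sum_exponents:
  fixes u w :: "'i \<Rightarrow> nat"
  assumes "d > 0" "finite I" "sum u I \<ge> 2 * d - 1"
  obtains c where "\<And>i. i \<in> I \<Longrightarrow> c i \<le> u i" "sum c I = d" "d dvd (\<Sum>i\<in>I. w i * c i)"
proof -
  define S where "S = (SIGMA i:I. {..<u i})"
  have "finite S" "card S = sum u I"
    using \<open>finite I\<close> by (auto simp: S_def)
  then obtain T where T: "T \<subseteq> S" "card T = d" "d dvd sum (w \<circ> fst) T"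
    using Erdos_Ginzburg_Ziv[of d S "w \<circ> fst"] assms by auto
  define c where "c i = card {x \<in> T. fst x = i}" for i
  have finT: "finite T"
    using T \<open>finite S\<close> finite_subset by blast
  \<comment> \<open>Summing over the fibres of \<open>fst\<close> serves twice: with constant 1 for
    the degree, and with the weights for the divisibility.\<close>
  have fib: "(\<Sum>i\<in>I. \<Sum>x\<in>{x \<in> T. fst x = i}. g x) = sum g T" for g :: "'i \<times> nat \<Rightarrow> nat"
    using T finT \<open>finite I\<close> by (intro sum.group) (auto simp: S_def)
  have "c i \<le> u i" if "i \<in> I" for i
  proof -
    have "{x \<in> T. fst x = i} \<subseteq> Pair i ` {..<u i}"
      using T by (auto simp: S_def)
    then have "c i \<le> card (Pair i ` {..<u i})"
      unfolding c_def by (intro card_mono) auto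
    then show ?thesis
      by (simp add: card_image inj_on_def)
  qed
  moreover have "sum c I = d"
    using fib[of "\<lambda>_. 1"] T by (simp add: c_def)
  moreover have "(\<Sum>i\<in>I. w i * c i) = (\<Sum>i\<in>I. \<Sum>x\<in>{x \<in> T. fst x = i}. (w \<circ> fst) x)"
    by (intro sum.cong) (auto simp: c_def)
  then have "d dvd (\<Sum>i\<in>I. w i * c i)"
    using fib[of "w \<circ> fst"] T by simp
  ultimately show thesis
    by (rule that)
qed

text \<open>Strong induction on the total degree, a positive multiple of \<open>d\<close>; in
  degrees \<open>d\<close> and \<open>2 * d\<close> the vector \<open>a\<close> itself serves as
  \<open>b\<close>.\<close>

lemma positive_exponents_reduction:
  fixes a w :: "'i \<Rightarrow> nat"
  assumes "d > 0" "finite I" "I \<noteq> {}" "card I \<le> d"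
    and "\<And>i. i \<in> I \<Longrightarrow> 0 < a i" "d dvd sum a I" "d dvd (\<Sum>i\<in>I. w i * a i)"
  shows "\<exists>b. (\<forall>i\<in>I. 0 < b i \<and> b i \<le> a i) \<and> (sum b I = d \<or> sum b I = 2 * d)
    \<and> d dvd (\<Sum>i\<in>I. w i * b i)"
  using assms(5-7)
proof (induction "sum a I" arbitrary: a rule: less_induct)
  case less
  obtain k where k: "sum a I = d * k"
    using less.prems by blast
  have "sum a I > 0"
    using less.prems assms by (intro sum_pos) auto
  then consider "k = 1" | "k = 2" | "k \<ge> 3"
    using k by fastforce
  then show ?case
  proof cases
    case 3
    \<comment> \<open>Lowering every entry by one costs \<open>card I\<close>, at most
      \<open>d\<close>, so at least \<open>2 * d\<close> of the degree is left for the zero-sum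
      selection.\<close>
    have "(\<Sum>i\<in>I. a i - 1) + card I = sum a I"
    proof -
      have "(\<Sum>i\<in>I. a i - 1) + card I = (\<Sum>i\<in>I. (a i - 1) + 1)"
        by (simp only: sum.distrib card_eq_sum)
      also have "\<dots> = sum a I"
        using less.prems by (intro sum.cong) auto
      finally show ?thesis .
    qed
    moreover have "sum a I \<ge> d * 3"
      using k 3 by simp
    ultimately have "(\<Sum>i\<in>I. a i - 1) \<ge> 2 * d - 1"
      using \<open>card I \<le> d\<close> by linarith
    then obtain c where c: "\<And>i. i \<in> I \<Longrightarrow> c i \<le> a i - 1" "sum c I = d" "d dvd (\<Sum>i\<in>I. w i * c i)"
      using zero_sum_exponents[of d I "\<lambda>i. a i - 1" w] assms by blast
    \<comment> \<open>Strictness keeps \<open>a i - c i\<close> positive and makes the truncated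
      subtractions below exact.\<close>
    have le: "c i < a i" if "i \<in> I" for i
      using c(1)[OF that] less.prems(1)[OF that] by linarith
    have sum: "(\<Sum>i\<in>I. a i - c i) = sum a I - sum c I"
      using le by (intro sum_subtractf_nat) (auto intro: less_imp_le)
    have "(\<Sum>i\<in>I. w i * (a i - c i)) = (\<Sum>i\<in>I. w i * a i) - (\<Sum>i\<in>I. w i * c i)"
      using le by (subst sum_subtractf_nat [symmetric]) (auto simp: diff_mult_distrib2 intro: less_imp_le)
    moreover have "(\<Sum>i\<in>I. a i - c i) < sum a I"
      using sum c \<open>d > 0\<close> \<open>sum a I > 0\<close> by simp
    ultimately obtain b where b: "\<forall>i\<in>I. 0 < b i \<and> b i \<le> a i - c i" "sum b I = d \<or> sum b I = 2 * d"
      "d dvd (\<Sum>i\<in>I. w i * b i)"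
      using less.hyps[of "\<lambda>i. a i - c i"] le sum c less.prems by auto
    have "\<forall>i\<in>I. 0 < b i \<and> b i \<le> a i"
      using b(1) by (meson diff_le_self le_trans)
    then show ?thesis
      using b by blast
  qed (use k less.prems in \<open>auto intro!: exI[of _ a]\<close>)
qed

section \<open>Invariant monomials\<close>

lemma mon_add: "mon (a + b) = (mon a * mon b :: 'a::comm_ring_1 mpoly)"
  by (simp add: mon_def mult_single)

lemma const_mult: "const (x * y) = const x * const y"
  by (simp add: const_def mult_single)

lemma const_1: "const 1 = 1"
  by (simp add: const_def)

lemma const_power: "const (x ^ k) = const x ^ k"
  by (induction k) (simp_all add: const_1 const_mult)

lemma const_prod: "const (prod f A) = (\<Prod>i\<in>A. const (f i))"
  by (induction A rule: infinite_finite_induct) (simp_all add: const_1 const_mult)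

lemma mon_sum: "finite A \<Longrightarrow> mon (sum f A) = (\<Prod>i\<in>A. mon (f i))"
  by (induction A rule: finite_induct) (simp_all add: mon_add, simp add: mon_def)

lemma var_power: "var i ^ k = mon (Poly_Mapping.single i k)"
proof (induction k)
  case (Suc k)
  have "Poly_Mapping.single i (Suc k) = Poly_Mapping.single i 1 + Poly_Mapping.single i k"
    by (simp flip: single_add)
  then show ?case
    using Suc by (simp add: mon_add) (simp add: mon_def var_def)
qed (simp add: mon_def)

lemma mon_eq_prod_var:
  assumes "Poly_Mapping.keys a \<subseteq> {..n}"
  shows "mon a = (\<Prod>i\<le>n. var i ^ Poly_Mapping.lookup a i)"
proof -
  have "a = (\<Sum>i\<le>n. Poly_Mapping.single i (Poly_Mapping.lookup a i))"
    using assms by (intro poly_mapping_eqI) (auto simp: lookup_sum lookup_single when_def in_keys_iff)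
  then have "mon a = mon (\<Sum>i\<le>n. Poly_Mapping.single i (Poly_Mapping.lookup a i))"
    by simp
  also have "\<dots> = (\<Prod>i\<le>n. var i ^ Poly_Mapping.lookup a i)"
    by (simp add: mon_sum var_power)
  finally show ?thesis .
qed

text \<open>In each row only the diagonal entry survives, so the substitution merely rescales
  variables and monomials are eigenvectors.\<close>

lemma act_mat_diag_mon:
  fixes f :: "nat \<Rightarrow> 'a::comm_ring_1"
  assumes "Poly_Mapping.keys a \<subseteq> {..n}"
  shows "act (mat_diag (n + 1) f) (mon a) =
    const (\<Prod>i\<le>n. f i ^ Poly_Mapping.lookup a i) * mon a"
proof -
  have row: "(\<Sum>j<n + 1. const (mat_diag (n + 1) f $$ (i, j)) * var j) = const (f i) * var i"
    if "i \<le> n" for i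
  proof -
    have "(\<Sum>j<n + 1. const (mat_diag (n + 1) f $$ (i, j)) * var j) =
        (\<Sum>j<n + 1. if j = i then const (f i) * var i else 0)"
      using that by (intro sum.cong) (auto simp: mat_diag_def const_def)
    then show ?thesis
      using that by simp
  qed
  have "act (mat_diag (n + 1) f) (mon a) =
      (\<Prod>i<n + 1. (\<Sum>j<n + 1. const (mat_diag (n + 1) f $$ (i, j)) * var j) ^ Poly_Mapping.lookup a i)"
    by (simp add: act_def mon_def const_1 mat_diag_def)
  also have "\<dots> = (\<Prod>i\<le>n. (const (f i) * var i) ^ Poly_Mapping.lookup a i)"
    using row by (intro prod.cong) (auto simp del: sum.lessThan_Suc)
  also have "\<dots> = const (\<Prod>i\<le>n. f i ^ Poly_Mapping.lookup a i) * (\<Prod>i\<le>n. var i ^ Poly_Mapping.lookup a i)"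
    by (simp add: power_mult_distrib prod.distrib const_prod const_power)
  finally show ?thesis
    by (simp add: mon_eq_prod_var[OF assms])
qed

lemma act_mat_diag_mon_eq_iff:
  fixes f :: "nat \<Rightarrow> 'a::comm_ring_1"
  assumes "Poly_Mapping.keys a \<subseteq> {..n}"
  shows "act (mat_diag (n + 1) f) (mon a) = mon a \<longleftrightarrow> (\<Prod>i\<le>n. f i ^ Poly_Mapping.lookup a i) = 1"
proof -
  have "const c * mon a = Poly_Mapping.single a c" for c :: 'a
    by (simp add: const_def mon_def mult_single)
  then show ?thesis
    unfolding act_mat_diag_mon[OF assms] by (metis lookup_single_eq mon_def)
qed

lemma mat_diag_in_GL:
  fixes f :: "nat \<Rightarrow> 'a::field"
  assumes "\<And>i. f i \<noteq> 0"
  shows "mat_diag N f \<in> carrier (GL N)"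
    and "inv\<^bsub>GL N\<^esub> (mat_diag N f) = mat_diag N (\<lambda>i. inverse (f i))"
proof -
  interpret ring "ring_mat TYPE('a) N ()"
    by (rule ring_mat)
  interpret G: group "GL N :: 'a mat monoid"
    unfolding GL_def by (rule units_group)
  have GL: "mat_diag N g \<in> carrier (GL N)" if "\<And>i. g i \<noteq> 0" for g :: "nat \<Rightarrow> 'a"
  proof -
    have "mat_diag N (\<lambda>i. inverse (g i)) * mat_diag N g = 1\<^sub>m N"
      "mat_diag N g * mat_diag N (\<lambda>i. inverse (g i)) = 1\<^sub>m N"
      using that by simp_all
    then show ?thesis
      unfolding GL_def units_of_carrier Units_def
      by (auto simp: ring_mat_def intro!: bexI[of _ "mat_diag N (\<lambda>i. inverse (g i))"])
  qed
  show "mat_diag N f \<in> carrier (GL N)"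
    using assms by (rule GL)
  show "inv\<^bsub>GL N\<^esub> (mat_diag N f) = mat_diag N (\<lambda>i. inverse (f i))"
    using assms
    by (intro G.inv_equality GL) (simp_all add: GL_def units_of_def ring_mat_def)
qed

text \<open>The induction carries diagonal form with eigenvalue 1 on the monomial. This is
  multiplicative in the diagonal entries, so it passes to products and inverses without composing
  substitutions.\<close>

lemma generate_mat_diag_invariant:
  fixes H :: "'a::field mat set"
  assumes a: "Poly_Mapping.keys a \<subseteq> {..n}"
    and H: "\<And>A. A \<in> H \<Longrightarrow> \<exists>f. (\<forall>i. f i \<noteq> 0) \<and> A = mat_diag (n + 1) f \<and> act A (mon a) = mon a"
    and A: "A \<in> generate (GL (n + 1)) H"
  shows "act A (mon a) = mon a"
proof -
  define P where "P f \<longleftrightarrow> (\<Prod>i\<le>n. f i ^ Poly_Mapping.lookup a i) = 1" for f :: "nat \<Rightarrow> 'a"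
  have gen: "\<exists>f. (\<forall>i. f i \<noteq> 0) \<and> A = mat_diag (n + 1) f \<and> P f" if "A \<in> H" for A
    using H[OF that] act_mat_diag_mon_eq_iff[OF a] unfolding P_def by metis
  have "\<exists>f. A = mat_diag (n + 1) f \<and> P f"
    using A
  proof (induction rule: generate.induct)
    case one
    have "\<one>\<^bsub>GL (n + 1)\<^esub> = mat_diag (n + 1) (\<lambda>_. 1 :: 'a)"
      by (simp add: GL_def units_of_def ring_mat_def)
    moreover have "P (\<lambda>_. 1)"
      by (simp add: P_def)
    ultimately show ?case
      by blast
  next
    case (incl A)
    then show ?case
      using gen by blast
  next
    case (inv A)
    \<comment> \<open>\<open>generate\<close> applies inverses to generators only, and their
      diagonal entries are known to be nonzero.\<close>
    then obtain f where f: "\<forall>i. f i \<noteq> 0" "A = mat_diag (n + 1) f" "P f"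
      using gen by blast
    have "P (\<lambda>i. inverse (f i))"
      using f(3) prod_inversef[of "\<lambda>i. f i ^ Poly_Mapping.lookup a i" "{..n}"]
      by (simp add: P_def power_inverse comp_def)
    then show ?case
      using mat_diag_in_GL(2)[of f] f by blast
  next
    case (eng A B)
    then obtain f g where fg: "A = mat_diag (n + 1) f" "P f" "B = mat_diag (n + 1) g" "P g"
      by blast
    have "P (\<lambda>i. f i * g i)"
      using fg by (simp add: P_def power_mult_distrib prod.distrib)
    moreover have "A \<otimes>\<^bsub>GL (n + 1)\<^esub> B = mat_diag (n + 1) (\<lambda>i. f i * g i)"
      using fg by (simp add: GL_def units_of_def ring_mat_def)
    ultimately show ?case
      by blast
  qed
  then show ?thesis
    using act_mat_diag_mon_eq_iff[OF a] by (auto simp: P_def)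
qed

text \<open>The exponent matters only modulo \<open>d\<close>, and primitivity rules out every
  nonzero remainder.\<close>

lemma primitive_root_power_eq_1_iff:
  assumes "primitive_root_of_unity d e"
  shows "e ^ k = 1 \<longleftrightarrow> d dvd k"
proof -
  have "e ^ k = e ^ (d * (k div d) + k mod d)"
    by simp
  also have "\<dots> = e ^ (k mod d)"
    using assms by (simp only: power_add power_mult) (simp add: primitive_root_of_unity_def)
  finally show ?thesis
    using assms by (auto simp: primitive_root_of_unity_def dvd_eq_mod_eq_0)
qed

text \<open>Translates invariance into arithmetic: the two generators scale \<open>mon a\<close> by
  \<open>e\<close> raised to its weighted degree and to its degree, and invariance under them passes
  to the whole group.\<close>

lemma mon_in_R_Gam_bar_iff:
  fixes e :: "'a::field"
  assumes e: "primitive_root_of_unity d e"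
  shows "(mon a :: 'a mpoly) \<in> carrier (R_Gam_bar n e \<alpha>) \<longleftrightarrow>
    Poly_Mapping.keys a \<subseteq> {..n} \<and> d dvd (\<Sum>i\<le>n. Poly_Mapping.lookup a i) \<and>
    d dvd (\<Sum>i\<le>n. \<alpha> i * Poly_Mapping.lookup a i)"
proof (cases "Poly_Mapping.keys a \<subseteq> {..n}")
  case a: True
  have e0: "e \<noteq> 0"
    using e by (auto simp: primitive_root_of_unity_def power_0_left split: if_splits)
  let ?H = "{diag_M n e \<alpha>, mat_diag (n + 1) (\<lambda>_. e)}"
  have "mon a \<in> carrier (R_Gam_bar n e \<alpha>) \<longleftrightarrow> (\<forall>A\<in>generate (GL (n + 1)) ?H. act A (mon a) = mon a)"
    using a by (simp add: R_Gam_bar_def invariant_ring_def poly_ring_def Gam_bar_def) (simp add: mon_def)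
  also have "\<dots> \<longleftrightarrow> (\<forall>A\<in>?H. act A (mon a) = mon a)"
  proof
    assume inv: "\<forall>A\<in>?H. act A (mon a) = mon a"
    have "\<exists>f. (\<forall>i. f i \<noteq> 0) \<and> A = mat_diag (n + 1) f \<and> act A (mon a) = mon a" if "A \<in> ?H" for A
    proof -
      have "A = mat_diag (n + 1) (\<lambda>i. e ^ \<alpha> i) \<or> A = mat_diag (n + 1) (\<lambda>_. e)"
        using that by (auto simp: diag_M_def)
      moreover have "act A (mon a) = mon a"
        using inv that by blast
      ultimately show ?thesis
        using e0 by (metis power_not_zero)
    qed
    then show "\<forall>A\<in>generate (GL (n + 1)) ?H. act A (mon a) = mon a"
      using generate_mat_diag_invariant[OF a] by blast
  qed (blast intro: generate.incl)
  also have "\<dots> \<longleftrightarrow> e ^ (\<Sum>i\<le>n. \<alpha> i * Poly_Mapping.lookup a i) = 1 \<and> e ^ (\<Sum>i\<le>n. Poly_Mapping.lookup a i) = 1"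
    by (simp only: ball_simps diag_M_def act_mat_diag_mon_eq_iff[OF a] power_sum power_mult simp_thms)
  finally show ?thesis
    using a primitive_root_power_eq_1_iff[OF e] by blast
next
  case False
  then have "(mon a :: 'a mpoly) \<notin> carrier (poly_ring n)"
    by (simp add: poly_ring_def mon_def)
  then show ?thesis
    using False by (simp add: R_Gam_bar_def invariant_ring_def)
qed

lemma ex_poly_mapping_restrict:
  fixes f :: "'b \<Rightarrow> 'c::zero"
  assumes "finite A"
  obtains b where "\<And>i. Poly_Mapping.lookup b i = (if i \<in> A then f i else 0)"
proof
  have "finite {i. (if i \<in> A then f i else 0) \<noteq> 0}"
    using assms by (rule rev_finite_subset) auto
  then show "Poly_Mapping.lookup (Abs_poly_mapping (\<lambda>i. if i \<in> A then f i else 0)) i = (if i \<in> A then f i else 0)" for i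
    by (simp add: Abs_poly_mapping_inverse)
qed

lemma positive_invariant_decomposition:
  fixes e :: "'a::field"
  assumes e: "primitive_root_of_unity d e" and "n < d"
    and a: "(mon a :: 'a mpoly) \<in> carrier (R_Gam_bar n e \<alpha>)" "(\<Prod>i\<le>n. Poly_Mapping.lookup a i) \<noteq> 0"
  obtains b c where "a = c + b"
    "(mon b :: 'a mpoly) \<in> carrier (R_Gam_bar n e \<alpha>)" "(mon c :: 'a mpoly) \<in> carrier (R_Gam_bar n e \<alpha>)"
    "(\<Prod>i\<le>n. Poly_Mapping.lookup b i) \<noteq> 0" "mon_degree b = 1 * d \<or> mon_degree b = 2 * d"
proof -
  note iff = mon_in_R_Gam_bar_iff[OF e]
  have keys: "Poly_Mapping.keys a \<subseteq> {..n}"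
    and dvd: "d dvd (\<Sum>i\<le>n. Poly_Mapping.lookup a i)" "d dvd (\<Sum>i\<le>n. \<alpha> i * Poly_Mapping.lookup a i)"
    using a iff by blast+
  have "\<exists>g. (\<forall>i\<in>{..n}. 0 < g i \<and> g i \<le> Poly_Mapping.lookup a i) \<and> (sum g {..n} = d \<or> sum g {..n} = 2 * d)
      \<and> d dvd (\<Sum>i\<le>n. \<alpha> i * g i)"
    \<comment> \<open>There are \<open>n + 1\<close> variables, at most \<open>d\<close> because
      \<open>n < d\<close>.\<close>
    using dvd a(2) \<open>n < d\<close> by (intro positive_exponents_reduction) auto
  then obtain g where g: "\<And>i. i \<le> n \<Longrightarrow> 0 < g i" "\<And>i. i \<le> n \<Longrightarrow> g i \<le> Poly_Mapping.lookup a i"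
    "sum g {..n} = d \<or> sum g {..n} = 2 * d" "d dvd (\<Sum>i\<le>n. \<alpha> i * g i)"
    by auto
  obtain b where b: "\<And>i. Poly_Mapping.lookup b i = (if i \<in> {..n} then g i else 0)"
    using ex_poly_mapping_restrict[of "{..n}" g] by blast
  have le: "Poly_Mapping.lookup b i \<le> Poly_Mapping.lookup a i" for i
    using g b by simp
  have keysb: "Poly_Mapping.keys b \<subseteq> {..n}"
    by (auto simp: in_keys_iff b split: if_splits)
  have sumb: "(\<Sum>i\<le>n. Poly_Mapping.lookup b i) = sum g {..n}"
    "(\<Sum>i\<le>n. \<alpha> i * Poly_Mapping.lookup b i) = (\<Sum>i\<le>n. \<alpha> i * g i)"
    by (simp_all add: b)
  have dvdb: "d dvd (\<Sum>i\<le>n. Poly_Mapping.lookup b i)" "d dvd (\<Sum>i\<le>n. \<alpha> i * Poly_Mapping.lookup b i)"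
    unfolding sumb using g by auto
  have "mon_degree b = (\<Sum>i\<le>n. Poly_Mapping.lookup b i)"
    unfolding mon_degree_def using keysb by (intro sum.mono_neutral_left) (auto simp: in_keys_iff)
  then have deg: "mon_degree b = 1 * d \<or> mon_degree b = 2 * d"
    using sumb g by simp
  have ab: "a = (a - b) + b"
    using le by (intro poly_mapping_eqI) (simp add: lookup_add lookup_minus)
  have keysc: "Poly_Mapping.keys (a - b) \<subseteq> {..n}"
    using keys by (auto simp: in_keys_iff lookup_minus intro!: subsetD[OF keys])
  have "(\<Sum>i\<le>n. Poly_Mapping.lookup (a - b) i) = (\<Sum>i\<le>n. Poly_Mapping.lookup a i) - (\<Sum>i\<le>n. Poly_Mapping.lookup b i)"
    unfolding lookup_minus using le by (intro sum_subtractf_nat) auto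
  moreover have "(\<Sum>i\<le>n. \<alpha> i * Poly_Mapping.lookup (a - b) i) =
      (\<Sum>i\<le>n. \<alpha> i * Poly_Mapping.lookup a i) - (\<Sum>i\<le>n. \<alpha> i * Poly_Mapping.lookup b i)"
    unfolding lookup_minus diff_mult_distrib2 using le by (intro sum_subtractf_nat) auto
  \<comment> \<open>Both congruences survive subtraction, so the quotient monomial is invariant too;
    its exponents may vanish.\<close>
  ultimately have "(mon (a - b) :: 'a mpoly) \<in> carrier (R_Gam_bar n e \<alpha>)"
    unfolding iff using keysc dvd dvdb by (simp add: dvd_diff_nat)
  moreover have "(mon b :: 'a mpoly) \<in> carrier (R_Gam_bar n e \<alpha>)"
    using iff keysb dvdb by blast
  moreover have "(\<Prod>i\<le>n. Poly_Mapping.lookup b i) \<noteq> 0"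
    using g(1) by (simp add: b)
  ultimately show thesis
    using that ab deg by blast
qed

theorem theorem4p2:
  fixes e :: "'a :: {alg_closed_field, field_char_0}"
    and n d :: nat
    and \<alpha> :: "nat \<Rightarrow> nat"
  assumes "2 \<le> n" and "n < d"
    and "primitive_root_of_unity d e"
    and "\<And>i j. i \<le> j \<Longrightarrow> j \<le> n \<Longrightarrow> \<alpha> i \<le> \<alpha> j"
    and "\<alpha> n < d"
    and "Gcd (insert d (\<alpha> ` {..n})) = 1"
    and "\<exists>i\<le>n. \<exists>j\<le>n. i \<noteq> j \<and> \<alpha> i < \<alpha> j"
    and "card (Gam n e \<alpha>) = d"
  shows "relint_I n e \<alpha> =
    Idl\<^bsub>R_Gam_bar n e \<alpha>\<^esub> (C_set n e \<alpha> d 1 \<union> C_set n e \<alpha> d 2)"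
proof -
  let ?R = "R_Gam_bar n e \<alpha>"
  let ?C = "C_set n e \<alpha> d 1 \<union> C_set n e \<alpha> d 2"
  define gens :: "'a mpoly set" where
    "gens = {mon a | a. mon a \<in> carrier ?R \<and> (\<Prod>i\<le>n. Poly_Mapping.lookup a i) \<noteq> 0}"
  have relint: "relint_I n e \<alpha> = Idl\<^bsub>?R\<^esub> gens"
    by (simp add: relint_I_def gens_def)
  have gens_sub: "gens \<subseteq> Idl\<^bsub>?R\<^esub> gens"
    by (auto simp: genideal_def)
  \<comment> \<open>\<open>Idl\<close> is the intersection of all ideals containing a set, so it
    suffices to place the generators in every ideal that contains \<open>?C\<close>.\<close>
  have "gens \<subseteq> J" if J: "ideal J ?R" "?C \<subseteq> J" for J
  proof
    fix x assume "x \<in> gens"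
    then obtain a where x: "x = mon a"
      and a: "(mon a :: 'a mpoly) \<in> carrier ?R" "(\<Prod>i\<le>n. Poly_Mapping.lookup a i) \<noteq> 0"
      by (auto simp: gens_def)
    obtain b c where bc: "a = c + b"
      "(mon b :: 'a mpoly) \<in> carrier ?R" "(mon c :: 'a mpoly) \<in> carrier ?R"
      "(\<Prod>i\<le>n. Poly_Mapping.lookup b i) \<noteq> 0" "mon_degree b = 1 * d \<or> mon_degree b = 2 * d"
      using positive_invariant_decomposition[OF assms(3,2) a] .
    have "mon b \<in> relint_I n e \<alpha>"
      unfolding relint using gens_sub bc by (auto simp: gens_def)
    then have "mon b \<in> J"
      using J(2) bc(5) by (auto simp: C_set_def)
    \<comment> \<open>The invariant cofactor \<open>mon c\<close> is absorbed by the ideal, and the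
      product is the given generator.\<close>
    then have "mon c \<otimes>\<^bsub>?R\<^esub> mon b \<in> J"
      using ideal.I_l_closed[OF J(1)] bc by blast
    then show "x \<in> J"
      by (simp add: x bc(1) mon_add R_Gam_bar_def invariant_ring_def poly_ring_def)
  qed
  then have "Idl\<^bsub>?R\<^esub> gens \<subseteq> Idl\<^bsub>?R\<^esub> ?C"
    by (auto simp: genideal_def)
  moreover have "?C \<subseteq> Idl\<^bsub>?R\<^esub> gens"
    by (auto simp: C_set_def relint)
  then have "Idl\<^bsub>?R\<^esub> ?C \<subseteq> Idl\<^bsub>?R\<^esub> gens"
    by (auto simp: genideal_def)
  ultimately show ?thesis
    by (simp add: relint)
qed

end
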